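(* Let $k\geq 2$ be a fixed positive integer and let $G$ be a fixed graph with $|V(G)|=m$, $\chi(G)=q$ and $\eta(G)=\eta$. There exists a threshold $N(G,k)$ such that for any $n\geq N(G,k)$ and for any $\mathcal{A}\subseteq {[n]\choose k}$, if $\operatorname{KG}_{n,k}[\mathcal{A}]$ has no subgraph isomorphic to $G$, then $$|\mathcal{A}|\leq {n\choose k}-{n-q+1\choose k}+\eta-1.$$ Moreover, the equality holds if and only if there is a $(q-1)$-set $L\subseteq [n]$ such that $|\mathcal{A}\setminus C(L)|=\eta-1$ and $\operatorname{KG}_{n,k}[\mathcal{A}\setminus C(L)]$ has no subgraph isomorphic to a special subgraph of $G$.
   Context: $[n]=\{1,\ldots,n\}$ and ${[n]\choose k}$ is the family of all $k$-subsets of $[n]$. The Kneser graph $\operatorname{KG}_{n,k}$ has vertex set ${[n]\choose k}$, two vertices being adjacent iff the corresponding sets are disjoint; for $\mathcal{A}\subseteq{[n]\choose k}$, $\operatorname{KG}_{n,k}[\mathcal{A}]$ is the induced subgraph on $\mathcal{A}$. For $L\subseteq[n]$, $C(L)=\{A\in{[n]\choose k}: A\cap L\neq\varnothing\}$. For a graph $G$ with $\chi(G)=q$, $\eta(G)$ is the minimum, over all proper $q$-colorings $(U_1,\ldots,U_q)$ of $G$, of $\min_{i\in[q]}|U_i|$. A subgraph of $G$ is called special if removing its vertices from $G$ reduces the chromatic number by one.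
   Formalization: Special subgraphs are taken to be induced subgraphs of G, and the equality condition also requires C(L) ⊆ 𝒜; read literally the equivalence is false (e.g. 𝒜 = ∅ for G = K₂ for the "if" part, double stars for the "only if" part). *)

theory Defs
  imports "Graph_Theory.Graph_Theory" "HOL-Library.Ramsey"
begin

text \<open>
  Finite simple graphs are the symmetric digraphs of the locale \<^locale>\<open>graph\<close>: every edge
  is represented by its two arcs, and the graph without vertices is allowed.
\<close>

definition proper_coloring :: "('a, 'b) pre_digraph \<Rightarrow> nat \<Rightarrow> ('a \<Rightarrow> nat) \<Rightarrow> bool" where
  "proper_coloring G q c \<longleftrightarrow>
     (\<forall>v \<in> verts G. c v < q) \<and> (\<forall>(u, v) \<in> arcs_ends G. c u \<noteq> c v)"

definition chromatic_number :: "('a, 'b) pre_digraph \<Rightarrow> nat" where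
  "chromatic_number G = (LEAST q. \<exists>c. proper_coloring G q c)"

definition color_class :: "('a, 'b) pre_digraph \<Rightarrow> ('a \<Rightarrow> nat) \<Rightarrow> nat \<Rightarrow> 'a set" where
  "color_class G c i = {v \<in> verts G. c v = i}"

text \<open>
  The minimum size of a color class over all optimal colorings. For a finite graph the sizes are
  bounded by the number of vertices, so the outer minimum is over a finite set even though there
  may be infinitely many functions \<open>c\<close>. The value is unspecified for the graph without vertices,
  whose colorings have no color classes.
\<close>

definition min_color_class :: "('a, 'b) pre_digraph \<Rightarrow> nat" where
  "min_color_class G =
     Min {Min ((\<lambda>i. card (color_class G c i)) ` {..<chromatic_number G}) | c.
            proper_coloring G (chromatic_number G) c}"

definition contains_copy :: "('c, 'd) pre_digraph \<Rightarrow> ('a, 'b) pre_digraph \<Rightarrow> bool" where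
  "contains_copy K G \<longleftrightarrow> (\<exists>H. subgraph H K \<and> digraph_iso G H)"

text \<open>
  Special subgraphs are taken to be induced. If arbitrary subgraphs were allowed, the special
  subgraphs would include edgeless ones on the same vertex sets, and avoiding copies of special
  subgraphs would merely bound the number of vertices.
\<close>

definition special_subgraph :: "('a, 'b) pre_digraph \<Rightarrow> ('a, 'b) pre_digraph \<Rightarrow> bool" where
  "special_subgraph H G \<longleftrightarrow>
     induced_subgraph H G \<and>
     chromatic_number (G \<restriction> (verts G - verts H)) + 1 = chromatic_number G"

definition kneser_graph :: "nat \<Rightarrow> nat \<Rightarrow> (nat set, nat set \<times> nat set) pre_digraph" where
  "kneser_graph n k =
     with_proj \<lparr>pverts = nsets {1..n} k,
       parcs = {(A, B). A \<in> nsets {1..n} k \<and> B \<in> nsets {1..n} k \<and> A \<inter> B = {}}\<rparr>"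

text \<open>The \<open>k\<close>-subsets of \<open>{1..n}\<close> that meet \<open>L\<close>, written \<open>C(L)\<close>.\<close>

definition meeting_sets :: "nat \<Rightarrow> nat \<Rightarrow> nat set \<Rightarrow> nat set set" where
  "meeting_sets n k L = {A \<in> nsets {1..n} k. A \<inter> L \<noteq> {}}"

end

theory Submission
  imports Defs
begin

text \<open>
  Call an element popular if many members of the family contain it, i.e. more than a large constant
  times \<open>n ^ (k - 2)\<close>. At most that many \<open>k\<close>-sets through \<open>x\<close> meet a fixed bounded set avoiding \<open>x\<close>, so
  a colour class of \<open>G\<close> can be embedded greedily into the sets through a popular element. Hence there
  are at most \<open>q - 1\<close> popular elements. Let \<open>L\<close> be the set of these. A \<open>G\<close>-free family has no \<open>m\<close>
  pairwise disjoint members, so boundedly many elements meet all members outside \<open>C(L)\<close>, and as these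
  elements are unpopular there are only \<open>O(n ^ (k - 2))\<close> such members. If \<open>card L < q - 1\<close>, the
  family is therefore too small. If \<open>card L = q - 1\<close>, then fewer than \<open>\<eta>\<close> members avoid \<open>L\<close>:
  otherwise a smallest colour class fits into them and the other \<open>q - 1\<close> classes are embedded
  greedily. The same greedy step excludes special subgraphs outside \<open>C(L)\<close>.
\<close>

section \<open>Counting \<open>k\<close>-sets that contain or meet given elements\<close>

lemma card_nsets:
  assumes "finite A"
  shows "card (nsets A k) = card A choose k"
proof -
  have "nsets A k = {B. B \<subseteq> A \<and> card B = k}"
    using assms finite_subset unfolding nsets_def by blast
  then show ?thesis using n_subsets[OF assms] by simp
qed

lemma card_meeting_sets:
  assumes "L \<subseteq> {1..n}"
  shows "card (meeting_sets n k L) + ((n - card L) choose k) = n choose k"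
proof -
  have eq: "nsets {1..n} k = meeting_sets n k L \<union> nsets ({1..n} - L) k"
    unfolding meeting_sets_def nsets_def by blast
  have disj: "meeting_sets n k L \<inter> nsets ({1..n} - L) k = {}"
    unfolding meeting_sets_def nsets_def by blast
  have fin: "finite (nsets {1..n} k)" by (simp add: finite_imp_finite_nsets)
  have "card (nsets {1..n} k) = card (meeting_sets n k L) + card (nsets ({1..n} - L) k)"
    using eq disj fin by (metis card_Un_disjoint finite_Un)
  moreover have "card ({1..n} - L) = n - card L"
    using assms by (simp add: card_Diff_subset finite_subset)
  ultimately show ?thesis by (simp add: card_nsets)
qed

lemma card_UN_le_mult:
  assumes "finite I" and "\<And>i. i \<in> I \<Longrightarrow> card (A i) \<le> b"
  shows "card (\<Union>i\<in>I. A i) \<le> card I * b"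
  using card_UN_le[OF assms(1), of A] sum_bounded_above[of I "\<lambda>i. card (A i)" b] assms(2)
  by fastforce

definition set_degree :: "'a set set \<Rightarrow> 'a \<Rightarrow> nat" where
  "set_degree \<A> x = card {A \<in> \<A>. x \<in> A}"

text \<open>Deleting the pair is injective on these sets and leaves \<open>(k - 2)\<close>-subsets.
  The crude power of \<open>n\<close> is one order below the size of a typical degree.\<close>

lemma card_containing_pair:
  fixes x y n k :: nat
  assumes "x \<noteq> y"
  shows "card {A \<in> nsets {1..n} k. x \<in> A \<and> y \<in> A} \<le> n ^ (k - 2)"
proof -
  let ?S = "{A \<in> nsets {1..n} k. x \<in> A \<and> y \<in> A}"
  have "card ?S \<le> card (nsets {1..n} (k - 2))"
  proof (rule card_inj_on_le)
    show "inj_on (\<lambda>A. A - {x, y}) ?S" by (rule inj_onI) blast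
    show "(\<lambda>A. A - {x, y}) ` ?S \<subseteq> nsets {1..n} (k - 2)"
      using assms by (auto simp: nsets_def card_Diff_subset)
    show "finite (nsets {1..n} (k - 2))" by (simp add: finite_imp_finite_nsets)
  qed
  also have "\<dots> = n choose (k - 2)" by (simp add: card_nsets)
  also have "\<dots> \<le> n ^ (k - 2)"
    by (cases "k - 2 \<le> n") (simp_all add: binomial_le_pow binomial_eq_0)
  finally show ?thesis .
qed

lemma card_containing_meeting:
  fixes x n k :: nat
  assumes "finite S" and "x \<notin> S"
  shows "card {A \<in> nsets {1..n} k. x \<in> A \<and> A \<inter> S \<noteq> {}} \<le> card S * n ^ (k - 2)"
proof -
  have "{A \<in> nsets {1..n} k. x \<in> A \<and> A \<inter> S \<noteq> {}}
      = (\<Union>y\<in>S. {A \<in> nsets {1..n} k. x \<in> A \<and> y \<in> A})"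
    by blast
  moreover have "card \<dots> \<le> card S * n ^ (k - 2)"
    using assms by (intro card_UN_le_mult card_containing_pair) auto
  ultimately show ?thesis by simp
qed

section \<open>Greedy selection through popular elements\<close>

text \<open>One step of the greedy selection: too few \<open>k\<close>-sets through \<open>x\<close>
  meet \<open>S\<close> to account for the whole degree of \<open>x\<close>.\<close>

lemma popular_avoiding:
  fixes \<A> :: "nat set set"
  assumes "\<A> \<subseteq> nsets {1..n} k" and "set_degree \<A> x > T * n ^ (k - 2)"
    and "finite S" and "x \<notin> S" and "card S \<le> T"
  shows "\<exists>B\<in>\<A>. x \<in> B \<and> B \<inter> S = {}"
proof (rule ccontr)
  assume "\<not> ?thesis"
  then have "{A \<in> \<A>. x \<in> A} \<subseteq> {A \<in> nsets {1..n} k. x \<in> A \<and> A \<inter> S \<noteq> {}}"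
    using assms(1) by blast
  then have "set_degree \<A> x \<le> card {A \<in> nsets {1..n} k. x \<in> A \<and> A \<inter> S \<noteq> {}}"
    unfolding set_degree_def by (intro card_mono) (auto simp: finite_imp_finite_nsets)
  also have "\<dots> \<le> card S * n ^ (k - 2)"
    using assms by (intro card_containing_meeting)
  also have "\<dots> \<le> T * n ^ (k - 2)" using assms(5) by simp
  finally show False using assms(2) by simp
qed

text \<open>Members are chosen one vertex at a time, that of \<open>v\<close> through the element
  \<open>c v\<close> of \<open>L\<close>. The set \<open>F\<close> collects the points of the part
  of a copy that is already placed. Vertices of equal color share a point, so intersections are only
  confined to \<open>L\<close>; distinct colors then give disjoint members.\<close>

lemma greedy_embedding:
  fixes \<A> :: "nat set set"
  assumes "finite V" and sub: "\<A> \<subseteq> nsets {1..n} k" and "finite L" and "finite F" and "F \<inter> L = {}"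
    and "c ` V \<subseteq> L" and pop: "\<And>x. x \<in> L \<Longrightarrow> set_degree \<A> x > T * n ^ (k - 2)"
    and "card L + card F + k * card V \<le> T"
  shows "\<exists>f. f ` V \<subseteq> \<A> \<and> (\<forall>v\<in>V. f v \<inter> L = {c v} \<and> f v \<inter> F = {}) \<and>
           (\<forall>u\<in>V. \<forall>v\<in>V. u \<noteq> v \<longrightarrow> f u \<inter> f v \<subseteq> L)"
  using assms(1,6,8)
proof (induction V rule: finite_induct)
  case empty
  then show ?case by simp
next
  case (insert w V)
  then obtain f where f: "f ` V \<subseteq> \<A>" "\<And>v. v \<in> V \<Longrightarrow> f v \<inter> L = {c v} \<and> f v \<inter> F = {}"
    "\<And>u v. u \<in> V \<Longrightarrow> v \<in> V \<Longrightarrow> u \<noteq> v \<Longrightarrow> f u \<inter> f v \<subseteq> L"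
    by fastforce
  let ?W = "\<Union>v\<in>V. f v"
  \<comment> \<open>The points that the new member must avoid. Its own color \<open>c w\<close> is
    exempt, although earlier members of the same color contain it too.\<close>
  let ?S = "(L \<union> F \<union> ?W) - {c w}"
  have fk: "finite (f v) \<and> card (f v) = k" if "v \<in> V" for v
    using f(1) sub that unfolding nsets_def by blast
  have fin: "finite ?W" using fk insert.hyps(1) by auto
  have "card ?S \<le> card (L \<union> F \<union> ?W)"
    using fin assms(3,4) by (intro card_mono) auto
  also have "\<dots> \<le> card L + card F + card ?W"
    using card_Un_le[of L F] card_Un_le[of "L \<union> F" ?W] by linarith
  also have "card ?W \<le> card V * k"
    using fk insert.hyps(1) by (intro card_UN_le_mult) auto
  also have "card L + card F + card V * k \<le> T"
    using insert.prems(2) insert.hyps by (simp add: algebra_simps)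
  finally have "card ?S \<le> T" by simp
  moreover have cw: "c w \<in> L" using insert.prems by simp
  ultimately obtain B where B: "B \<in> \<A>" "c w \<in> B" "B \<inter> ?S = {}"
    using popular_avoiding[OF sub pop[OF cw], of ?S] fin assms(3,4) by auto
  let ?f = "f(w := B)"
  have B1: "B \<inter> L = {c w} \<and> B \<inter> F = {}" using B cw assms(5) by blast
  have B2: "B \<inter> f v \<subseteq> L" if "v \<in> V" for v using B cw that by blast
  have "?f ` insert w V \<subseteq> \<A>" using f(1) B(1) insert.hyps(2) by auto
  moreover have "\<forall>v\<in>insert w V. ?f v \<inter> L = {c v} \<and> ?f v \<inter> F = {}"
    using f(2) B1 by simp
  moreover have "\<forall>u\<in>insert w V. \<forall>v\<in>insert w V. u \<noteq> v \<longrightarrow> ?f u \<inter> ?f v \<subseteq> L"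
    using f(3) B2 by (auto simp: Int_commute)
  ultimately show ?case by blast
qed

section \<open>Disjoint members versus small covers\<close>

text \<open>A disjoint family either grows by a member that misses its union, or its union is
  already a cover.\<close>

lemma disjoint_members_or_small_cover:
  assumes "\<And>A. A \<in> \<B> \<Longrightarrow> finite A \<and> card A = k" and "k > 0"
  shows "(\<exists>M \<subseteq> \<B>. finite M \<and> card M = m \<and> pairwise disjnt M) \<or>
         (\<exists>S. finite S \<and> card S \<le> m * k \<and> (\<forall>A\<in>\<B>. A \<inter> S \<noteq> {}))"
proof (induction m)
  case 0
  show ?case by (rule disjI1, rule exI[of _ "{}"]) simp
next
  case (Suc m)
  then consider (M) M where "M \<subseteq> \<B>" "finite M" "card M = m" "pairwise disjnt M"
    | (S) S where "finite S" "card S \<le> m * k" "\<forall>A\<in>\<B>. A \<inter> S \<noteq> {}"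
    by blast
  then show ?case
  proof cases
    case M
    have fin: "finite (\<Union>M)" using M assms(1) by blast
    have "card (\<Union>A\<in>M. A) \<le> card M * k"
      using M assms(1) by (intro card_UN_le_mult) auto
    then have cd: "card (\<Union>M) \<le> Suc m * k" using M(3) by simp
    show ?thesis
    proof (cases "\<forall>A\<in>\<B>. A \<inter> \<Union>M \<noteq> {}")
      case True
      then show ?thesis using fin cd by blast
    next
      case False
      then obtain A where A: "A \<in> \<B>" "A \<inter> \<Union>M = {}" by blast
      \<comment> \<open>An empty \<open>A\<close> would miss the union even if it were already in
        \<open>M\<close>; \<open>k > 0\<close> excludes this, so the cardinality really
        increases.\<close>
      have "A \<noteq> {}" using assms A(1) by force
      then have "A \<notin> M" using A(2) by blast
      then have "card (insert A M) = Suc m" using M by simp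
      moreover have "pairwise disjnt (insert A M)"
        using M(4) A(2) unfolding pairwise_def disjnt_def by blast
      ultimately show ?thesis using M A(1)
        by (intro disjI1 exI[of _ "insert A M"]) auto
    qed
  next
    case S
    then show ?thesis by (intro disjI2 exI[of _ S]) auto
  qed
qed

section \<open>Copies of a graph in Kneser graphs\<close>

text \<open>Arcs of the Kneser graph are pairs of vertices, so a vertex map determines the arc map.
  Without parallel arcs in \<open>G\<close> that arc map is injective. Copies need not be induced,
  hence the single implication on arcs.\<close>

lemma contains_copy_kneser_iff:
  fixes G :: "('a, 'b) pre_digraph"
  assumes "\<A> \<subseteq> nsets {1..n} k" and "nomulti_digraph G"
  shows "contains_copy (kneser_graph n k \<restriction> \<A>) G \<longleftrightarrow>
    (\<exists>f. inj_on f (verts G) \<and> f ` verts G \<subseteq> \<A> \<and>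
      (\<forall>u v. (u, v) \<in> arcs_ends G \<longrightarrow> f u \<inter> f v = {}))"
    (is "?L \<longleftrightarrow> ?R")
proof -
  interpret nomulti_digraph G by fact
  let ?K = "kneser_graph n k \<restriction> \<A>"
  have K: "verts ?K = \<A>" "tail ?K = fst" "head ?K = snd"
    "arcs ?K = {(A, B). A \<in> \<A> \<and> B \<in> \<A> \<and> A \<inter> B = {}}"
    using assms(1) unfolding induce_subgraph_def kneser_graph_def by auto
  show ?thesis
  proof
    assume ?L
    then obtain h where h: "digraph_isomorphism h" and sub: "subgraph (app_iso h G) ?K"
      unfolding contains_copy_def digraph_iso_def by blast
    from sub have ht: "iso_tail h = fst" "iso_head h = snd" and V: "iso_verts h ` verts G \<subseteq> \<A>"
      and E: "iso_arcs h ` arcs G \<subseteq> arcs ?K"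
      unfolding subgraph_def compatible_def K by simp_all
    have "iso_verts h (tail G e) \<inter> iso_verts h (head G e) = {}" if "e \<in> arcs G" for e
    proof -
      have "iso_arcs h e \<in> arcs ?K" using E that by blast
      then have "fst (iso_arcs h e) \<inter> snd (iso_arcs h e) = {}" unfolding K by auto
      then show ?thesis using h that ht unfolding digraph_isomorphism_def by simp
    qed
    then have "\<forall>u v. (u, v) \<in> arcs_ends G \<longrightarrow> iso_verts h u \<inter> iso_verts h v = {}"
      unfolding arcs_ends_conv by auto
    moreover have "inj_on (iso_verts h) (verts G)" using h unfolding digraph_isomorphism_def by simp
    ultimately show ?R using V by (intro exI[of _ "iso_verts h"] conjI)
  next
    assume ?R
    then obtain f where f: "inj_on f (verts G)" "f ` verts G \<subseteq> \<A>"
      "\<And>u v. (u, v) \<in> arcs_ends G \<Longrightarrow> f u \<inter> f v = {}" by blast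
    \<comment> \<open>Taking \<open>fst\<close> and \<open>snd\<close> as tail and head makes the
      image of \<open>G\<close> compatible with \<open>kneser_graph\<close>.\<close>
    define h where "h = \<lparr>iso_verts = f, iso_arcs = (\<lambda>e. (f (tail G e), f (head G e))),
      iso_head = snd, iso_tail = fst\<rparr>"
    have "inj_on (\<lambda>e. (f (tail G e), f (head G e))) (arcs G)"
    proof (rule inj_onI)
      fix e e' assume e: "e \<in> arcs G" "e' \<in> arcs G"
        "(f (tail G e), f (head G e)) = (f (tail G e'), f (head G e'))"
      then have "tail G e = tail G e'" "head G e = head G e'"
        by (simp_all add: inj_on_eq_iff[OF f(1)])
      then show "e = e'" using no_multi_arcs e unfolding arc_to_ends_def by simp
    qed
    then have iso: "digraph_isomorphism h"
      using f(1) wf_digraph unfolding digraph_isomorphism_def h_def by simp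
    have "f (tail G e) \<inter> f (head G e) = {}" if "e \<in> arcs G" for e
      using f(3) that unfolding arcs_ends_conv by blast
    then have "subgraph (app_iso h G) ?K"
      unfolding subgraph_def compatible_def wf_digraph_def K app_iso_def h_def
      using f(2) by auto
    then show ?L using iso unfolding contains_copy_def digraph_iso_def by blast
  qed
qed

text \<open>Common form of all later embeddings: \<open>U\<close> is already placed away from
  \<open>L\<close>, and the other vertices, properly colored by elements of \<open>L\<close>, follow
  greedily. It is applied with \<open>U\<close> empty, a color class, or the vertex set of a special
  subgraph.\<close>

lemma contains_copy_extend:
  fixes G :: "('a, 'b) pre_digraph" and \<A> :: "nat set set"
  assumes "digraph G" and "k \<ge> 2" and sub: "\<A> \<subseteq> nsets {1..n} k"
    and U: "U \<subseteq> verts G" and g: "inj_on g U" "g ` U \<subseteq> \<A>"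
    and gL: "\<And>u. u \<in> U \<Longrightarrow> g u \<inter> L = {}"
    and gE: "\<And>u v. (u, v) \<in> arcs_ends G \<Longrightarrow> u \<in> U \<Longrightarrow> v \<in> U \<Longrightarrow> g u \<inter> g v = {}"
    and L: "finite L" and c: "c ` (verts G - U) \<subseteq> L"
    and cE: "\<And>u v. (u, v) \<in> arcs_ends G \<Longrightarrow> u \<notin> U \<Longrightarrow> v \<notin> U \<Longrightarrow> c u \<noteq> c v"
    and pop: "\<And>x. x \<in> L \<Longrightarrow> set_degree \<A> x > T * n ^ (k - 2)"
    and T: "card L + card (verts G) * k \<le> T"
  shows "contains_copy (kneser_graph n k \<restriction> \<A>) G"
proof -
  interpret digraph G by fact
  let ?V = "verts G - U" and ?F = "\<Union>u\<in>U. g u"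
  have finU: "finite U" using U finite_verts finite_subset by blast
  have A: "finite A \<and> card A = k" if "A \<in> \<A>" for A using sub that unfolding nsets_def by blast
  then have gk: "finite (g u) \<and> card (g u) = k" if "u \<in> U" for u using g(2) that by blast
  have "card ?F \<le> card U * k" using gk finU by (intro card_UN_le_mult) auto
  moreover have "card ?V + card U = card (verts G)"
    using U finU by (simp add: card_Diff_subset card_mono)
  then have "card ?V * k + card U * k = card (verts G) * k" by (metis add_mult_distrib)
  ultimately have T': "card L + card ?F + k * card ?V \<le> T"
    using T by (simp add: mult.commute)
  have F: "finite ?F" "?F \<inter> L = {}" using gk finU gL by auto
  obtain f where "f ` ?V \<subseteq> \<A> \<and> (\<forall>v\<in>?V. f v \<inter> L = {c v} \<and> f v \<inter> ?F = {}) \<and>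
      (\<forall>u\<in>?V. \<forall>v\<in>?V. u \<noteq> v \<longrightarrow> f u \<inter> f v \<subseteq> L)"
    using greedy_embedding[OF finite_Diff[OF finite_verts] sub L F c pop T'] ..
  then have f: "f ` ?V \<subseteq> \<A>" "\<And>v. v \<in> ?V \<Longrightarrow> f v \<inter> L = {c v} \<and> f v \<inter> ?F = {}"
    "\<And>u v. u \<in> ?V \<Longrightarrow> v \<in> ?V \<Longrightarrow> u \<noteq> v \<Longrightarrow> f u \<inter> f v \<subseteq> L"
    by simp_all
  let ?h = "\<lambda>v. if v \<in> U then g v else f v"
  have fg: "g u \<inter> f v = {}" if "u \<in> U" "v \<in> ?V" for u v using f(2)[OF that(2)] that by blast
  have fg': "g u \<noteq> f v" if "u \<in> U" "v \<in> ?V" for u v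
    using fg[OF that] gk[OF that(1)] assms(2) by auto
  \<comment> \<open>Equal images would lie inside \<open>L\<close> and thus be the singleton
    \<open>{c u}\<close>, which \<open>k \<ge> 2\<close> forbids.\<close>
  have ff: "f u \<noteq> f v" if "u \<in> ?V" "v \<in> ?V" "u \<noteq> v" for u v
  proof
    assume "f u = f v"
    then have "f u = {c u}" using f(2,3) that by blast
    moreover have "card (f u) = k" using f(1) that A by blast
    ultimately show False using assms(2) by simp
  qed
  have "inj_on ?h (verts G)"
  proof (rule inj_onI)
    fix u v assume uv: "u \<in> verts G" "v \<in> verts G" "?h u = ?h v"
    show "u = v"
      using uv fg'[of u v] fg'[of v u] ff[of u v]
      by (cases "u \<in> U"; cases "v \<in> U") (auto simp: inj_on_eq_iff[OF g(1)])
  qed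
  moreover have "?h ` verts G \<subseteq> \<A>" using f(1) g(2) by auto
  moreover have "?h u \<inter> ?h v = {}" if uv: "(u, v) \<in> arcs_ends G" for u v
  proof -
    have V: "u \<in> verts G" "v \<in> verts G" "u \<noteq> v"
      using uv no_loops unfolding arcs_ends_conv by auto
    show ?thesis
    proof (cases "u \<in> U \<or> v \<in> U")
      case True
      then show ?thesis using V gE[OF uv] fg[of u v] fg[of v u] by auto
    next
      case False
      then have "f u \<inter> f v \<subseteq> (f u \<inter> L) \<inter> (f v \<inter> L)" using f(3) V by blast
      also have "\<dots> = {c u} \<inter> {c v}" using f(2) V False by simp
      also have "\<dots> = {}" using cE[OF uv] False by auto
      finally show ?thesis using False by auto
    qed
  qed
  ultimately show ?thesis
    unfolding contains_copy_kneser_iff[OF sub nomulti_digraph]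
    by (intro exI[of _ ?h] conjI allI impI)
qed

section \<open>Optimal colorings and their color classes\<close>

text \<open>The \<open>LEAST\<close> in \<open>chromatic_number\<close> needs a witness: without
  loops, an injective numbering of the vertices is proper.\<close>

lemma ex_optimal_coloring:
  assumes "finite (verts G)" and "loopfree_digraph G"
  shows "\<exists>c. proper_coloring G (chromatic_number G) c"
proof -
  interpret loopfree_digraph G by fact
  obtain h where h: "bij_betw h (verts G) {0..<card (verts G)}"
    using ex_bij_betw_finite_nat[OF assms(1)] by blast
  have "h u \<noteq> h v" if "(u, v) \<in> arcs_ends G" for u v
  proof -
    have "u \<in> verts G" "v \<in> verts G" "u \<noteq> v"
      using that no_loops unfolding arcs_ends_conv by auto
    then show ?thesis by (simp add: inj_on_eq_iff[OF bij_betw_imp_inj_on[OF h]])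
  qed
  then have "proper_coloring G (card (verts G)) h"
    using h unfolding proper_coloring_def bij_betw_def by auto
  then have "\<exists>q c. proper_coloring G q c" by blast
  then show ?thesis unfolding chromatic_number_def by (rule LeastI_ex)
qed

lemma chromatic_number_pos:
  assumes "finite (verts G)" and "loopfree_digraph G" and "verts G \<noteq> {}"
  shows "chromatic_number G > 0"
  using ex_optimal_coloring[OF assms(1,2)] assms(3) unfolding proper_coloring_def by fastforce

text \<open>If color \<open>i\<close> were free, the vertices of the last color could be recolored
  with \<open>i\<close>, which saves a color.\<close>

lemma color_class_nonempty:
  assumes "wf_digraph G" and c: "proper_coloring G (chromatic_number G) c"
    and "i < chromatic_number G"
  shows "color_class G c i \<noteq> {}"
proof
  assume empty: "color_class G c i = {}"
  interpret wf_digraph G by fact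
  let ?q = "chromatic_number G"
  let ?c = "\<lambda>v. if c v = ?q - 1 then i else c v"
  have ci: "c v \<noteq> i" if "v \<in> verts G" for v using empty that unfolding color_class_def by blast
  have lt: "c v < ?q" if "v \<in> verts G" for v using c that unfolding proper_coloring_def by blast
  have "?c v < ?q - 1" if "v \<in> verts G" for v
    using ci[OF that] lt[OF that] assms(3) by auto
  moreover have "?c u \<noteq> ?c v" if "(u, v) \<in> arcs_ends G" for u v
  proof -
    have "u \<in> verts G" "v \<in> verts G" using that unfolding arcs_ends_conv by auto
    moreover have "c u \<noteq> c v" using c that unfolding proper_coloring_def by blast
    ultimately show ?thesis using ci by auto
  qed
  ultimately have "proper_coloring G (?q - 1) ?c" unfolding proper_coloring_def by blast
  then have "?q \<le> ?q - 1" unfolding chromatic_number_def by (intro Least_le) blast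
  then show False using assms(3) by simp
qed

text \<open>Both minima are over finite nonempty sets: the inner one because there is at least one
  color, the outer one because class sizes are at most \<open>card (verts G)\<close>.\<close>

lemma min_color_class_attained:
  assumes "finite (verts G)" and "loopfree_digraph G" and "chromatic_number G > 0"
  shows "\<exists>c i. proper_coloring G (chromatic_number G) c \<and> i < chromatic_number G \<and>
    card (color_class G c i) = min_color_class G"
proof -
  let ?q = "chromatic_number G"
  let ?f = "\<lambda>c. Min ((\<lambda>i. card (color_class G c i)) ` {..<?q})"
  let ?M = "{?f c | c. proper_coloring G ?q c}"
  have att: "?f c \<in> (\<lambda>i. card (color_class G c i)) ` {..<?q}" for c
    using assms(3) by (intro Min_in) auto
  have "card (color_class G c i) \<le> card (verts G)" for c i
    using assms(1) unfolding color_class_def by (intro card_mono) auto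
  then have "?f c \<le> card (verts G)" for c using att[of c] by auto
  then have "?M \<subseteq> {..card (verts G)}" by auto
  then have "finite ?M" using finite_subset by blast
  moreover have "?M \<noteq> {}" using ex_optimal_coloring[OF assms(1,2)] by blast
  ultimately have "min_color_class G \<in> ?M" unfolding min_color_class_def by (rule Min_in)
  then obtain c where "proper_coloring G ?q c" "min_color_class G = ?f c" by blast
  moreover from att[of c] obtain i where "i < ?q" "?f c = card (color_class G c i)" by blast
  ultimately show ?thesis by metis
qed

lemma min_color_class_pos:
  assumes "finite (verts G)" and "loopfree_digraph G" and "chromatic_number G > 0"
  shows "min_color_class G > 0"
proof -
  interpret loopfree_digraph G by fact
  obtain c i where ci: "proper_coloring G (chromatic_number G) c" "i < chromatic_number G"
    "card (color_class G c i) = min_color_class G"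
    using min_color_class_attained[OF assms] by blast
  have "finite (color_class G c i)" using assms(1) unfolding color_class_def by simp
  then show ?thesis
    using color_class_nonempty[OF wf_digraph ci(1,2)] ci(3) by (metis card_gt_0_iff)
qed

section \<open>Copies forced by popular elements\<close>

text \<open>With one popular element for each color of an optimal coloring, the greedy choice places
  all of \<open>G\<close>.\<close>

lemma contains_copy_of_popular:
  fixes G :: "('a, 'b) pre_digraph" and \<A> :: "nat set set"
  assumes G: "digraph G" and "k \<ge> 2" and "\<A> \<subseteq> nsets {1..n} k"
    and "finite L" and cL: "card L = chromatic_number G"
    and "\<And>x. x \<in> L \<Longrightarrow> set_degree \<A> x > T * n ^ (k - 2)"
    and "card L + card (verts G) * k \<le> T"
  shows "contains_copy (kneser_graph n k \<restriction> \<A>) G"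
proof -
  interpret digraph G by fact
  obtain c where c: "proper_coloring G (chromatic_number G) c"
    using ex_optimal_coloring[OF finite_verts loopfree_digraph_axioms] by blast
  obtain h where h: "bij_betw h {0..<card L} L"
    using ex_bij_betw_nat_finite assms(4) by blast
  have lt: "c v < card L" if "v \<in> verts G" for v
    using c that cL unfolding proper_coloring_def by auto
  show ?thesis
  proof (rule contains_copy_extend[where U = "{}" and g = "\<lambda>_. {}" and c = "h \<circ> c" and L = L and T = T])
    show "(h \<circ> c) ` (verts G - {}) \<subseteq> L" using h lt unfolding bij_betw_def by auto
    fix u v assume uv: "(u, v) \<in> arcs_ends G"
    then have "u \<in> verts G" "v \<in> verts G" unfolding arcs_ends_conv by auto
    moreover have "c u \<noteq> c v" using c uv unfolding proper_coloring_def by blast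
    ultimately show "(h \<circ> c) u \<noteq> (h \<circ> c) v"
      using lt by (simp add: inj_on_eq_iff[OF bij_betw_imp_inj_on[OF h]])
  qed (use assms in auto)
qed

text \<open>A color class is independent, so any injection into the members avoiding
  \<open>L\<close> places a smallest one. The other colors are matched with the elements of
  \<open>L\<close>.\<close>

lemma contains_copy_of_min_color_class:
  fixes G :: "('a, 'b) pre_digraph" and \<A> :: "nat set set"
  assumes G: "digraph G" and "k \<ge> 2" and sub: "\<A> \<subseteq> nsets {1..n} k"
    and "finite L" and cL: "card L + 1 = chromatic_number G"
    and "\<And>x. x \<in> L \<Longrightarrow> set_degree \<A> x > T * n ^ (k - 2)"
    and "card L + card (verts G) * k \<le> T"
    and B: "min_color_class G \<le> card (\<A> - meeting_sets n k L)"
  shows "contains_copy (kneser_graph n k \<restriction> \<A>) G"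
proof -
  interpret digraph G by fact
  let ?q = "chromatic_number G"
  obtain c i where c: "proper_coloring G ?q c" and i: "i < ?q"
    and ci: "card (color_class G c i) = min_color_class G"
    using min_color_class_attained[OF finite_verts loopfree_digraph_axioms] cL by auto
  let ?U = "color_class G c i"
  have U: "?U \<subseteq> verts G" "finite ?U" unfolding color_class_def by auto
  have "finite \<A>" by (rule finite_subset[OF sub]) (simp add: finite_imp_finite_nsets)
  then obtain g where g: "g ` ?U \<subseteq> \<A> - meeting_sets n k L" "inj_on g ?U"
    using card_le_inj[of ?U "\<A> - meeting_sets n k L"] U ci B by auto
  have "card ({..<?q} - {i}) = card L" using i cL by simp
  then obtain h where h: "bij_betw h ({..<?q} - {i}) L"
    using finite_same_card_bij[of "{..<?q} - {i}" L] assms(4) by auto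
  have cm: "c v \<in> {..<?q} - {i}" if "v \<in> verts G" "v \<notin> ?U" for v
    using c that unfolding proper_coloring_def color_class_def by auto
  have cE: "c u \<noteq> c v" if "(u, v) \<in> arcs_ends G" for u v
    using c that unfolding proper_coloring_def by blast
  show ?thesis
  proof (rule contains_copy_extend[where U = ?U and c = "h \<circ> c" and L = L and T = T and g = g])
    show "(h \<circ> c) ` (verts G - ?U) \<subseteq> L"
    proof
      fix y assume "y \<in> (h \<circ> c) ` (verts G - ?U)"
      then obtain v where "v \<in> verts G" "v \<notin> ?U" "y = h (c v)" by auto
      then show "y \<in> L" using h cm[of v] unfolding bij_betw_def by blast
    qed
    show "g ` ?U \<subseteq> \<A>" using g by blast
    show "g u \<inter> L = {}" if "u \<in> ?U" for u
      using g(1) that sub unfolding meeting_sets_def by blast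
  next
    fix u v assume uv: "(u, v) \<in> arcs_ends G" "u \<notin> ?U" "v \<notin> ?U"
    then have "u \<in> verts G" "v \<in> verts G" unfolding arcs_ends_conv by auto
    then have "c u \<in> {..<?q} - {i}" "c v \<in> {..<?q} - {i}" using cm uv by blast+
    then show "(h \<circ> c) u \<noteq> (h \<circ> c) v"
      using cE[OF uv(1)] by (simp add: inj_on_eq_iff[OF bij_betw_imp_inj_on[OF h]])
  next
    fix u v assume "(u, v) \<in> arcs_ends G" "u \<in> ?U" "v \<in> ?U"
    then show "g u \<inter> g v = {}" using cE[of u v] unfolding color_class_def by simp
  qed (use assms g U in auto)
qed

text \<open>Once a special subgraph is removed, \<open>card L\<close> colors suffice for the rest,
  one for each element of \<open>L\<close>. A copy of the subgraph away from \<open>L\<close>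
  therefore extends to all of \<open>G\<close>.\<close>

lemma contains_copy_of_special_subgraph:
  fixes G :: "('a, 'b) pre_digraph" and \<A> :: "nat set set"
  assumes G: "digraph G" and "k \<ge> 2" and sub: "\<A> \<subseteq> nsets {1..n} k"
    and "finite L" and cL: "card L + 1 = chromatic_number G"
    and "\<And>x. x \<in> L \<Longrightarrow> set_degree \<A> x > T * n ^ (k - 2)"
    and "card L + card (verts G) * k \<le> T"
    and H: "special_subgraph H G"
    and copy: "contains_copy (kneser_graph n k \<restriction> (\<A> - meeting_sets n k L)) H"
  shows "contains_copy (kneser_graph n k \<restriction> \<A>) G"
proof -
  interpret digraph G by fact
  let ?W = "verts G - verts H"
  let ?G = "G \<restriction> ?W"
  from H have ind: "induced_subgraph H G" and chr: "chromatic_number ?G = card L"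
    using cL unfolding special_subgraph_def by auto
  then have HG: "verts H \<subseteq> verts G" "wf_digraph H" "tail H = tail G" "head H = head G"
    "arcs H = {e \<in> arcs G. tail G e \<in> verts H \<and> head G e \<in> verts H}"
    unfolding induced_subgraph_def subgraph_def compatible_def by auto
  have "nomulti_digraph H"
    using HG no_multi_arcs unfolding nomulti_digraph_def nomulti_digraph_axioms_def
    by (auto simp: arc_to_ends_def)
  moreover have "\<A> - meeting_sets n k L \<subseteq> nsets {1..n} k" using sub by blast
  ultimately obtain g where g: "inj_on g (verts H)" "g ` verts H \<subseteq> \<A> - meeting_sets n k L"
    "\<And>u v. (u, v) \<in> arcs_ends H \<Longrightarrow> g u \<inter> g v = {}"
    using copy contains_copy_kneser_iff by metis
  have ends: "arcs_ends ?G = {(u, v) \<in> arcs_ends G. u \<in> ?W \<and> v \<in> ?W}"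
    unfolding arcs_ends_conv induce_subgraph_def by auto
  \<comment> \<open>This is where \<open>H\<close> must be induced: every arc of \<open>G\<close>
    inside \<open>verts H\<close> has to be respected by \<open>g\<close>.\<close>
  have endsH: "arcs_ends H = {(u, v) \<in> arcs_ends G. u \<in> verts H \<and> v \<in> verts H}"
    unfolding arcs_ends_conv HG by auto
  have "loopfree_digraph ?G"
    using no_loops unfolding loopfree_digraph_def loopfree_digraph_axioms_def wf_digraph_def
    by (auto simp: induce_subgraph_def)
  moreover have "finite (verts ?G)" by simp
  ultimately obtain c where "proper_coloring ?G (card L) c"
    using ex_optimal_coloring[of ?G] chr by auto
  then have lt: "\<And>v. v \<in> ?W \<Longrightarrow> c v < card L"
    and cE: "\<And>u v. (u, v) \<in> arcs_ends G \<Longrightarrow> u \<in> ?W \<Longrightarrow> v \<in> ?W \<Longrightarrow> c u \<noteq> c v"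
    unfolding proper_coloring_def ends by auto
  obtain h where h: "bij_betw h {0..<card L} L"
    using ex_bij_betw_nat_finite assms(4) by blast
  show ?thesis
  proof (rule contains_copy_extend[where U = "verts H" and c = "h \<circ> c" and L = L and T = T and g = g])
    show "(h \<circ> c) ` ?W \<subseteq> L" using h lt unfolding bij_betw_def by auto
    show "g ` verts H \<subseteq> \<A>" using g by blast
    show "g u \<inter> L = {}" if "u \<in> verts H" for u
      using g(2) that sub unfolding meeting_sets_def by blast
  next
    fix u v assume uv: "(u, v) \<in> arcs_ends G" "u \<notin> verts H" "v \<notin> verts H"
    then have W: "u \<in> ?W" "v \<in> ?W" unfolding arcs_ends_conv by auto
    then have "c u < card L" "c v < card L" "c u \<noteq> c v" using lt cE uv by auto
    then show "(h \<circ> c) u \<noteq> (h \<circ> c) v"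
      using h by (simp add: inj_on_eq_iff[OF bij_betw_imp_inj_on[OF h]])
  next
    fix u v assume "(u, v) \<in> arcs_ends G" "u \<in> verts H" "v \<in> verts H"
    then show "g u \<inter> g v = {}" using g(3) endsH by blast
  qed (use assms g HG in auto)
qed

text \<open>Pairwise disjoint members form a clique, and one with \<open>card (verts G)\<close>
  vertices contains \<open>G\<close>. So a small cover exists, and each of its points accounts for
  at most \<open>D\<close> members that avoid \<open>L\<close>.\<close>

lemma card_unpopular_le:
  fixes G :: "('a, 'b) pre_digraph" and \<A> :: "nat set set"
  assumes G: "digraph G" and "k \<ge> 2" and sub: "\<A> \<subseteq> nsets {1..n} k"
    and free: "\<not> contains_copy (kneser_graph n k \<restriction> \<A>) G"
    and unpop: "\<And>x. x \<in> {1..n} - L \<Longrightarrow> set_degree \<A> x \<le> D"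
  shows "card (\<A> - meeting_sets n k L) \<le> card (verts G) * k * D"
proof -
  interpret digraph G by fact
  let ?B = "\<A> - meeting_sets n k L"
  have finA: "finite \<A>" by (rule finite_subset[OF sub]) (simp add: finite_imp_finite_nsets)
  have mem: "finite A \<and> card A = k" if "A \<in> ?B" for A
    using sub that unfolding nsets_def by blast
  have no_clique: False
    if M: "M \<subseteq> ?B" "finite M" "card M = card (verts G)" "pairwise disjnt M" for M
  proof -
    obtain f where f: "bij_betw f (verts G) M"
      using finite_same_card_bij[OF finite_verts M(2)] M(3) by auto
    have "f u \<inter> f v = {}" if uv: "(u, v) \<in> arcs_ends G" for u v
    proof -
      have "u \<in> verts G" "v \<in> verts G" "u \<noteq> v"
        using uv no_loops unfolding arcs_ends_conv by auto
      then have "f u \<in> M" "f v \<in> M" "f u \<noteq> f v"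
        using f by (simp_all add: bij_betw_apply inj_on_eq_iff[OF bij_betw_imp_inj_on[OF f]])
      then show ?thesis using M(4) by (simp add: pairwise_def disjnt_def)
    qed
    moreover have "inj_on f (verts G)" "f ` verts G \<subseteq> \<A>"
      using f M(1) unfolding bij_betw_def by auto
    ultimately have "contains_copy (kneser_graph n k \<restriction> \<A>) G"
      unfolding contains_copy_kneser_iff[OF sub nomulti_digraph]
      by (intro exI[of _ f] conjI allI impI)
    then show False using free by simp
  qed
  have "k > 0" using assms(2) by simp
  then have "(\<exists>M \<subseteq> ?B. finite M \<and> card M = card (verts G) \<and> pairwise disjnt M) \<or>
      (\<exists>S. finite S \<and> card S \<le> card (verts G) * k \<and> (\<forall>A\<in>?B. A \<inter> S \<noteq> {}))"
    using mem by (intro disjoint_members_or_small_cover) simp_all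
  moreover have "\<not> (\<exists>M \<subseteq> ?B. finite M \<and> card M = card (verts G) \<and> pairwise disjnt M)"
    by (intro notI, elim exE conjE, rule no_clique)
  ultimately obtain S where S: "finite S" "card S \<le> card (verts G) * k" "\<forall>A\<in>?B. A \<inter> S \<noteq> {}"
    by auto
  have deg: "card {A \<in> ?B. x \<in> A} \<le> D" for x
  proof (cases "x \<in> {1..n} - L")
    case True
    have "card {A \<in> ?B. x \<in> A} \<le> set_degree \<A> x"
      unfolding set_degree_def using finA by (intro card_mono) auto
    then show ?thesis using unpop[OF True] by simp
  next
    \<comment> \<open>The cover may contain points outside \<open>{1..n}\<close> or in
      \<open>L\<close>; these lie in no member of \<open>?B\<close>.\<close>
    case False
    then have "{A \<in> ?B. x \<in> A} = {}" using sub unfolding meeting_sets_def nsets_def by blast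
    then show ?thesis by (metis card.empty le0)
  qed
  have "?B = (\<Union>x\<in>S. {A \<in> ?B. x \<in> A})" using S(3) by blast
  then have "card ?B = card (\<Union>x\<in>S. {A \<in> ?B. x \<in> A})" by (rule arg_cong)
  also have "\<dots> \<le> card S * D" using S(1) deg by (intro card_UN_le_mult) auto
  also have "\<dots> \<le> card (verts G) * k * D" using S(2) by (rule mult_le_mono1)
  finally show ?thesis .
qed

section \<open>The threshold for \<open>n\<close> and the extremal bound\<close>

text \<open>Since \<open>n - q + 1\<close> is at least \<open>n / 2\<close>, the binomial
  coefficient is at least \<open>(n / (2 * k)) ^ (k - 1)\<close>, one order above the right
  side.\<close>

lemma binomial_gt_mult_pow:
  fixes n k q K :: nat
  assumes "k \<ge> 2" and "n \<ge> 2 * q" and "n \<ge> 2 * k" and "n > K * (2 * k) ^ (k - 1)"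
  shows "(n - q + 1) choose (k - 1) > K * n ^ (k - 2)"
proof -
  define N where "N = n - q + 1"
  have "k - 1 \<le> N" "n \<le> 2 * N" using assms(1-3) unfolding N_def by simp_all
  have k: "real (k - 1) > 0" using assms(1) by simp
  have "real n / real (2 * k) \<le> real N / real (k - 1)"
  proof -
    have "n * (k - 1) \<le> (2 * N) * k"
      using \<open>n \<le> 2 * N\<close> by (intro mult_le_mono) auto
    then have "real n * real (k - 1) \<le> real N * real (2 * k)"
      by (metis mult.assoc mult.commute of_nat_le_iff of_nat_mult)
    then show ?thesis using k assms(1) by (simp add: frac_le_eq divide_simps mult.commute)
  qed
  then have "(real n / real (2 * k)) ^ (k - 1) \<le> (real N / real (k - 1)) ^ (k - 1)"
    by (intro power_mono) auto
  also have "\<dots> \<le> real (N choose (k - 1))"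
    using binomial_ge_n_over_k_pow_k[OF \<open>k - 1 \<le> N\<close>, where ?'a = real] .
  finally have "real n ^ (k - 1) \<le> real (N choose (k - 1)) * real (2 * k) ^ (k - 1)"
    using assms(1) by (simp add: power_divide divide_simps)
  then have "real (n ^ (k - 1)) \<le> real ((N choose (k - 1)) * (2 * k) ^ (k - 1))"
    by simp
  then have le: "n ^ (k - 1) \<le> (N choose (k - 1)) * (2 * k) ^ (k - 1)"
    by (simp only: of_nat_le_iff)
  have "k - 1 = Suc (k - 2)" using assms(1) by simp
  then have "n ^ (k - 1) = n * n ^ (k - 2)" by (metis power_Suc)
  moreover have "n ^ (k - 2) > 0" using assms(1,3) by simp
  ultimately have "n ^ (k - 1) > (K * (2 * k) ^ (k - 1)) * n ^ (k - 2)"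
    using assms(4) by simp
  then have "(K * n ^ (k - 2)) * (2 * k) ^ (k - 1) < (N choose (k - 1)) * (2 * k) ^ (k - 1)"
    using le by (simp only: mult.commute mult.left_commute)
  then show ?thesis unfolding N_def by (simp only: mult_less_cancel2)
qed

text \<open>There are fewer than \<open>q\<close> popular elements. If even \<open>q - 1\<close> are
  not reached, the loss in \<open>meeting_sets n k L\<close> exceeds the number of members that
  avoid \<open>L\<close>.\<close>

lemma small_or_popular:
  fixes G :: "('a, 'b) pre_digraph" and \<A> :: "nat set set" and n k q T :: nat
  defines "q \<equiv> chromatic_number G"
  defines "T \<equiv> q + card (verts G) * k"
  assumes G: "digraph G" and "verts G \<noteq> {}" and "k \<ge> 2" and sub: "\<A> \<subseteq> nsets {1..n} k"
    and free: "\<not> contains_copy (kneser_graph n k \<restriction> \<A>) G"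
    and n: "n \<ge> 2 * q" "n \<ge> 2 * k" "n > card (verts G) * k * T * (2 * k) ^ (k - 1)"
  shows "card \<A> + ((n - q + 1) choose k) < n choose k \<or>
    (\<exists>L \<subseteq> {1..n}. card L + 1 = q \<and> (\<forall>x\<in>L. set_degree \<A> x > T * n ^ (k - 2)))"
proof -
  interpret digraph G by fact
  define L where "L = {x \<in> {1..n}. set_degree \<A> x > T * n ^ (k - 2)}"
  have L: "finite L" "L \<subseteq> {1..n}" unfolding L_def by auto
  have finA: "finite \<A>" by (rule finite_subset[OF sub]) (simp add: finite_imp_finite_nsets)
  have q: "q > 0" unfolding q_def
    using chromatic_number_pos[OF finite_verts loopfree_digraph_axioms] assms(4) .
  have "card L < q"
  proof (rule ccontr)
    assume "\<not> card L < q"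
    then obtain M where M: "M \<subseteq> L" "card M = q" "finite M"
      using obtain_subset_with_card_n[of q L] by (metis not_less)
    have "contains_copy (kneser_graph n k \<restriction> \<A>) G"
      by (rule contains_copy_of_popular[where L = M and T = T])
        (use M G sub assms(5) in \<open>auto simp: q_def T_def L_def\<close>)
    then show False using free by blast
  qed
  then consider "card L + 1 = q" | "card L + 2 \<le> q" by linarith
  then show ?thesis
  proof cases
    case 1
    then show ?thesis using L unfolding L_def by blast
  next
    case 2
    let ?C = "meeting_sets n k L"
    have "card (\<A> - ?C) \<le> card (verts G) * k * (T * n ^ (k - 2))"
      using sub free assms(5) G by (intro card_unpopular_le) (auto simp: L_def)
    also have "\<dots> < (n - q + 1) choose (k - 1)"
      using binomial_gt_mult_pow[OF assms(5) n] by (simp add: mult.assoc)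
    finally have small: "card (\<A> - ?C) < (n - q + 1) choose (k - 1)" .
    have "finite ?C" unfolding meeting_sets_def by (simp add: finite_imp_finite_nsets)
    then have "card (\<A> \<inter> ?C) \<le> card ?C" by (intro card_mono) auto
    then have "card \<A> \<le> card ?C + card (\<A> - ?C)"
      using card_Int_Diff[OF finA, of ?C] by linarith
    moreover have "card ?C + ((n - card L) choose k) = n choose k"
      by (rule card_meeting_sets) (rule L)
    moreover have "((n - q + 2) choose k) \<le> ((n - card L) choose k)"
      using 2 n q by (intro binomial_right_mono) linarith
    \<comment> \<open>Pascal's rule identifies the gap that beats \<open>small\<close>.\<close>
    moreover have "((n - q + 2) choose k) = ((n - q + 1) choose k) + ((n - q + 1) choose (k - 1))"
      using binomial_Suc_Suc[of "n - q + 1" "k - 1"] assms(5) by simp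
    ultimately show ?thesis using small by linarith
  qed
qed

text \<open>Integers keep the subtractions from truncating. The inclusion
  \<open>meeting_sets n k L \<subseteq> \<A>\<close> is explicit because, for nonempty
  \<open>L\<close>, deleting members that meet \<open>L\<close> lowers \<open>card \<A>\<close> but
  leaves \<open>\<A> - meeting_sets n k L\<close> unchanged.\<close>

theorem theorem1:
  fixes G :: "('a, 'b) pre_digraph" and k m q \<eta> :: nat
  assumes "k \<ge> 2"
    and "graph G"
    and "card (verts G) = m"
    and "chromatic_number G = q"
    and "min_color_class G = \<eta>"
  shows "\<exists>N. \<forall>n \<ge> N. \<forall>\<A>. \<A> \<subseteq> nsets {1..n} k \<and> \<not> contains_copy (kneser_graph n k \<restriction> \<A>) G \<longrightarrow>
    int (card \<A>) \<le> int (n choose k) - int ((n - q + 1) choose k) + int \<eta> - 1 \<and>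
    (int (card \<A>) = int (n choose k) - int ((n - q + 1) choose k) + int \<eta> - 1 \<longleftrightarrow>
      (\<exists>L. L \<subseteq> {1..n} \<and> card L = q - 1 \<and> meeting_sets n k L \<subseteq> \<A> \<and>
         card (\<A> - meeting_sets n k L) = \<eta> - 1 \<and>
         \<not> (\<exists>H. special_subgraph H G \<and>
               contains_copy (kneser_graph n k \<restriction> (\<A> - meeting_sets n k L)) H)))"
proof -
  interpret graph G by fact
  \<comment> \<open>Room for at most \<open>q\<close> popular elements and for all points of a full
    copy of \<open>G\<close>.\<close>
  define T where "T = q + card (verts G) * k"
  define N where "N = 2 * q + 2 * k + card (verts G) * k * T * (2 * k) ^ (k - 1) + 1"
  show ?thesis
  proof (intro exI[of _ N] allI impI, elim conjE)
    fix n \<A> assume "n \<ge> N" and sub: "\<A> \<subseteq> nsets {1..n} k"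
      and free: "\<not> contains_copy (kneser_graph n k \<restriction> \<A>) G"
    then have n: "n \<ge> 2 * q" "n \<ge> 2 * k" "n > card (verts G) * k * T * (2 * k) ^ (k - 1)"
      unfolding N_def by linarith+
    have finA: "finite \<A>" by (rule finite_subset[OF sub]) (simp add: finite_imp_finite_nsets)
    have finC: "finite (meeting_sets n k L)" for L
      unfolding meeting_sets_def by (simp add: finite_imp_finite_nsets)
    \<comment> \<open>The graph without vertices is contained in every graph. Excluding it yields
      \<open>q > 0\<close> and \<open>\<eta> > 0\<close>, so \<open>q - 1\<close> and
      \<open>\<eta> - 1\<close> are true predecessors.\<close>
    have "verts G \<noteq> {}"
    proof
      assume "verts G = {}"
      then have "arcs_ends G = {}" unfolding arcs_ends_conv using tail_in_verts by auto
      then show False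
        using free \<open>verts G = {}\<close> unfolding contains_copy_kneser_iff[OF sub nomulti_digraph] by simp
    qed
    then have q: "q > 0"
      using chromatic_number_pos[OF finite_verts loopfree_digraph_axioms] assms(4) by simp
    then have \<eta>: "\<eta> > 0"
      using min_color_class_pos[OF finite_verts loopfree_digraph_axioms] assms(4,5) by simp
    have C: "card (meeting_sets n k L) + ((n - q + 1) choose k) = n choose k"
      if "L \<subseteq> {1..n}" "card L = q - 1" for L
    proof -
      have "n - card L = n - q + 1" using that q n by simp
      then show ?thesis using card_meeting_sets[OF that(1), of k] by simp
    qed
    let ?eq = "int (card \<A>) = int (n choose k) - int ((n - q + 1) choose k) + int \<eta> - 1"
    let ?good = "\<lambda>L. L \<subseteq> {1..n} \<and> card L = q - 1 \<and> meeting_sets n k L \<subseteq> \<A> \<and>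
         card (\<A> - meeting_sets n k L) = \<eta> - 1 \<and>
         \<not> (\<exists>H. special_subgraph H G \<and>
               contains_copy (kneser_graph n k \<restriction> (\<A> - meeting_sets n k L)) H)"
    have good_imp_eq: ?eq if "?good L" for L
    proof -
      have "card (\<A> \<inter> meeting_sets n k L) = card (meeting_sets n k L)"
        using that by (simp add: Int_absorb1)
      then have "card \<A> = card (meeting_sets n k L) + (\<eta> - 1)"
        using card_Int_Diff[OF finA, of "meeting_sets n k L"] that by linarith
      then show ?thesis using C[of L] that \<eta> by linarith
    qed
    have "card \<A> + ((n - q + 1) choose k) < n choose k \<or>
      (\<exists>L \<subseteq> {1..n}. card L + 1 = q \<and> (\<forall>x\<in>L. set_degree \<A> x > T * n ^ (k - 2)))"
      using small_or_popular[OF digraph_axioms \<open>verts G \<noteq> {}\<close> assms(1) sub free] n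
      unfolding T_def assms(4) by blast
    then consider (small) "card \<A> + ((n - q + 1) choose k) < n choose k"
      | (pop) L where "L \<subseteq> {1..n}" "card L + 1 = q"
        "\<And>x. x \<in> L \<Longrightarrow> set_degree \<A> x > T * n ^ (k - 2)"
      by blast
    then show "int (card \<A>) \<le> int (n choose k) - int ((n - q + 1) choose k) + int \<eta> - 1 \<and>
      (?eq \<longleftrightarrow> (\<exists>L. ?good L))"
    proof cases
      case small
      then have "int (card \<A>) < int (n choose k) - int ((n - q + 1) choose k) + int \<eta> - 1"
        using \<eta> by linarith
      \<comment> \<open>Both sides of the equivalence fail here: a good \<open>L\<close> would force
        equality.\<close>
      then show ?thesis using good_imp_eq by fastforce
    next
      case pop
      let ?C = "meeting_sets n k L"
      have L: "finite L" "card L + 1 = chromatic_number G" "card L + card (verts G) * k \<le> T"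
        using pop assms(4) finite_subset unfolding T_def by auto
      have lt: "card (\<A> - ?C) < \<eta>"
        using contains_copy_of_min_color_class[OF digraph_axioms assms(1) sub L(1,2) pop(3) L(3)]
          free assms(5) by (meson not_less)
      have le: "card (\<A> \<inter> ?C) \<le> card ?C" using finC by (intro card_mono) auto
      have sum: "card \<A> = card (\<A> \<inter> ?C) + card (\<A> - ?C)" by (rule card_Int_Diff[OF finA])
      have CL: "card ?C + ((n - q + 1) choose k) = n choose k" using C pop by simp
      have "?good L" if ?eq
      proof -
        \<comment> \<open>Equality in the sum leaves no slack in either of the bounds
          \<open>le\<close> and \<open>lt\<close>.\<close>
        have eqs: "card (\<A> \<inter> ?C) = card ?C" "card (\<A> - ?C) = \<eta> - 1"
          using that lt le sum CL by linarith+
        then have "\<A> \<inter> ?C = ?C" using finC by (intro card_subset_eq) auto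
        then show ?thesis
          using eqs(2) pop free
            contains_copy_of_special_subgraph[OF digraph_axioms assms(1) sub L(1,2) pop(3) L(3)]
          by auto
      qed
      moreover have "int (card \<A>) \<le> int (n choose k) - int ((n - q + 1) choose k) + int \<eta> - 1"
        using lt le sum CL by linarith
      ultimately show ?thesis using good_imp_eq by blast
    qed
  qed
qed

end
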